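(* If $I$ is a normal Riesz $\gamma$-ideal in the GPEA $P$, then $I$ is a normal Riesz ideal in the $\gamma$-unitization $U$ of $P$ iff $\sim_I$ satisfies the (GCR) condition on $P$.
   Context: $P$ is a GPEA (partial $\oplus$, constant $0$; partial associativity; conjugation; two-sided cancellation; neutral $0$; positivity), ordered by $a\le b$ iff $a\oplus c=b$ for some $c$; for $a\le b$, $a/b$ is the unique $c$ with $a\oplus c=b$ and $b\backslash a$ the unique $d$ with $d\oplus a=b$. $\gamma$ is a unitizing GPEA-automorphism ($\gamma a\oplus b$ defined iff $b\oplus a$ defined). The $\gamma$-unitization $U=P\cup P^\eta$ ($\eta$ a bijection onto a disjoint set, $1:=\eta0$): sums in $P$ as in $P$; $a+\eta b$ defined iff $a\le b$, equal to $\eta(b\backslash a)$; $\eta a+b$ defined iff $\gamma b\le a$, equal to $\eta(\gamma b/a)$; no sums within $P^\eta$; $U$ is a pseudo effect algebra. Ideal: nonempty down-set closed under existing sums; normal: $a\oplus c=c\oplus b$ implies ($a\in I\Leftrightarrow b\in I$); $\gamma$-ideal: $a\in I\Leftrightarrow\gamma a\in I$. Riesz ideal: (R1) if $i\in I$, $i\le a\oplus b$ then $i\le j\oplus k$ for some $j,k\in I$, $j\le a$, $k\le b$; (R2) if $i\in I$, $i\le a$: (i) if $(a\backslash i)\oplus b$ exists there is $j\in I$, $j\le b$, with $a\oplus(j/b)$ existing; (ii) if $b\oplus(i/a)$ exists there is $k\in I$, $k\le b$, with $(b\backslash k)\oplus a$ existing. $a\sim_I b$ iff $a\backslash i=b\backslash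 j$ for some $i,j\in I$, $i\le a$, $j\le b$. (GCR): $a\sim_I b$ implies there exist $i,j\in I$ with $i\oplus a=j\oplus b$ (equivalently $k,\ell\in I$ with $a\oplus k=b\oplus\ell$). *)

theory Defs
  imports Main
begin

text \<open>
  A partial binary operation on \<^typ>\<open>'a\<close> is a function
  \<^typ>\<open>'a \<Rightarrow> 'a \<Rightarrow> 'a option\<close>; a sum is defined iff its value is not
  \<^term>\<open>None\<close>. The underlying set of a generalized pseudo effect algebra (GPEA) is the whole
  type, so that an arbitrary GPEA is given by an arbitrary type with such an operation.
\<close>

type_synonym 'a partial_op = "'a \<Rightarrow> 'a \<Rightarrow> 'a option"

text \<open>
  In \<open>assoc\<close>, \<^term>\<open>Option.bind (S a b) (\<lambda>s. S s c)\<close> is defined with value \<open>d\<close>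
  iff \<open>a \<oplus> b\<close> and \<open>(a \<oplus> b) \<oplus> c\<close> both exist and the latter equals \<open>d\<close>.
\<close>

locale gpea =
  fixes S :: "'a partial_op" and z :: 'a
  assumes assoc: "Option.bind (S a b) (\<lambda>s. S s c) = Option.bind (S b c) (\<lambda>t. S a t)"
    and conj: "S a b = Some s \<Longrightarrow> (\<exists>d e. S d a = Some s \<and> S b e = Some s)"
    and cancel_right: "S a c = Some s \<Longrightarrow> S b c = Some s \<Longrightarrow> a = b"
    and cancel_left: "S c a = Some s \<Longrightarrow> S c b = Some s \<Longrightarrow> a = b"
    and neutral_right: "S a z = Some a"
    and neutral_left: "S z a = Some a"
    and positive: "S a b = Some z \<Longrightarrow> a = z \<and> b = z"

definition sum_defined :: "'a partial_op \<Rightarrow> 'a \<Rightarrow> 'a \<Rightarrow> bool" where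
  "sum_defined S a b \<longleftrightarrow> (\<exists>s. S a b = Some s)"

definition le :: "'a partial_op \<Rightarrow> 'a \<Rightarrow> 'a \<Rightarrow> bool" where
  "le S a b \<longleftrightarrow> (\<exists>c. S a c = Some b)"

text \<open>
  \<^term>\<open>ldiff S a b\<close> is \<open>a / b\<close> and \<^term>\<open>rdiff S b a\<close> is \<open>b \ a\<close>. Both are
  meaningful only under \<^term>\<open>le S a b\<close>, and are used only under that hypothesis.
\<close>

definition ldiff :: "'a partial_op \<Rightarrow> 'a \<Rightarrow> 'a \<Rightarrow> 'a" where
  "ldiff S a b = (THE c. S a c = Some b)"

definition rdiff :: "'a partial_op \<Rightarrow> 'a \<Rightarrow> 'a \<Rightarrow> 'a" where
  "rdiff S b a = (THE d. S d a = Some b)"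

definition gpea_morphism :: "'a partial_op \<Rightarrow> 'b partial_op \<Rightarrow> ('a \<Rightarrow> 'b) \<Rightarrow> bool" where
  "gpea_morphism S T f \<longleftrightarrow> (\<forall>a b s. S a b = Some s \<longrightarrow> T (f a) (f b) = Some (f s))"

definition gpea_automorphism :: "'a partial_op \<Rightarrow> ('a \<Rightarrow> 'a) \<Rightarrow> bool" where
  "gpea_automorphism S f \<longleftrightarrow> bij f \<and> gpea_morphism S S f \<and> gpea_morphism S S (inv f)"

definition unitizing :: "'a partial_op \<Rightarrow> ('a \<Rightarrow> 'a) \<Rightarrow> bool" where
  "unitizing S \<gamma> \<longleftrightarrow>
     gpea_automorphism S \<gamma> \<and> (\<forall>a b. sum_defined S (\<gamma> a) b \<longleftrightarrow> sum_defined S b a)"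

text \<open>
  The underlying set of the unitization is the disjoint union of \<open>P\<close> (embedded by \<open>Emb\<close>)
  and its disjoint copy \<open>P\<^sup>\<eta>\<close> (the range of \<open>Eta\<close>); its zero is \<open>Emb 0\<close> and its
  unit is \<open>Eta 0\<close>.
\<close>

datatype 'a unitization = Emb 'a | Eta 'a

fun unitization_sum :: "'a partial_op \<Rightarrow> ('a \<Rightarrow> 'a) \<Rightarrow> 'a unitization partial_op" where
  "unitization_sum S \<gamma> (Emb a) (Emb b) = map_option Emb (S a b)"
| "unitization_sum S \<gamma> (Emb a) (Eta b) = (if le S a b then Some (Eta (rdiff S b a)) else None)"
| "unitization_sum S \<gamma> (Eta a) (Emb b) =
     (if le S (\<gamma> b) a then Some (Eta (ldiff S (\<gamma> b) a)) else None)"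
| "unitization_sum S \<gamma> (Eta a) (Eta b) = None"

definition is_ideal :: "'a partial_op \<Rightarrow> 'a set \<Rightarrow> bool" where
  "is_ideal S I \<longleftrightarrow>
     I \<noteq> {} \<and>
     (\<forall>a b. b \<in> I \<and> le S a b \<longrightarrow> a \<in> I) \<and>
     (\<forall>a b s. a \<in> I \<and> b \<in> I \<and> S a b = Some s \<longrightarrow> s \<in> I)"

definition is_normal :: "'a partial_op \<Rightarrow> 'a set \<Rightarrow> bool" where
  "is_normal S I \<longleftrightarrow>
     (\<forall>a b c s. S a c = Some s \<and> S c b = Some s \<longrightarrow> (a \<in> I \<longleftrightarrow> b \<in> I))"

definition gamma_closed :: "('a \<Rightarrow> 'a) \<Rightarrow> 'a set \<Rightarrow> bool" where
  "gamma_closed \<gamma> I \<longleftrightarrow> (\<forall>a. a \<in> I \<longleftrightarrow> \<gamma> a \<in> I)"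

definition riesz1 :: "'a partial_op \<Rightarrow> 'a set \<Rightarrow> bool" where
  "riesz1 S I \<longleftrightarrow>
     (\<forall>i a b s. i \<in> I \<and> S a b = Some s \<and> le S i s \<longrightarrow>
        (\<exists>j\<in>I. \<exists>k\<in>I. \<exists>t. S j k = Some t \<and> le S i t \<and> le S j a \<and> le S k b))"

definition riesz2 :: "'a partial_op \<Rightarrow> 'a set \<Rightarrow> bool" where
  "riesz2 S I \<longleftrightarrow>
     (\<forall>i a b. i \<in> I \<and> le S i a \<longrightarrow>
        (sum_defined S (rdiff S a i) b \<longrightarrow>
           (\<exists>j\<in>I. le S j b \<and> sum_defined S a (ldiff S j b))) \<and>
        (sum_defined S b (ldiff S i a) \<longrightarrow>
           (\<exists>k\<in>I. le S k b \<and> sum_defined S (rdiff S b k) a)))"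

definition normal_riesz_ideal :: "'a partial_op \<Rightarrow> 'a set \<Rightarrow> bool" where
  "normal_riesz_ideal S I \<longleftrightarrow> is_ideal S I \<and> is_normal S I \<and> riesz1 S I \<and> riesz2 S I"

definition ideal_sim :: "'a partial_op \<Rightarrow> 'a set \<Rightarrow> 'a \<Rightarrow> 'a \<Rightarrow> bool" where
  "ideal_sim S I a b \<longleftrightarrow>
     (\<exists>i\<in>I. \<exists>j\<in>I. le S i a \<and> le S j b \<and> rdiff S a i = rdiff S b j)"

definition GCR :: "'a partial_op \<Rightarrow> 'a set \<Rightarrow> bool" where
  "GCR S I \<longleftrightarrow>
     (\<forall>a b. ideal_sim S I a b \<longrightarrow>
        (\<exists>i\<in>I. \<exists>j\<in>I. \<exists>s. S i a = Some s \<and> S j b = Some s))"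

end

theory Submission
  imports Defs
begin

text \<open>
  In \<open>U\<close> one has \<open>a \<le> \<eta> b\<close> iff \<open>b \<oplus> a\<close> exists, and complementation turns existence of sums
  into order. The conditions (R1) and (R2) for \<open>I\<close> in \<open>U\<close> thereby become statements about \<open>P\<close>,
  of two kinds. The first says that \<open>b \<le> a \<oplus> i\<close> with \<open>i \<in> I\<close> forces \<open>b \ j \<le> a\<close> for some
  \<open>j \<in> I\<close>; this follows from (R1) in \<open>P\<close>. The second says that if \<open>d \<oplus> i\<close> and \<open>d \<oplus> e\<close> exist,
  \<open>i \<in> I\<close>, then \<open>d \<oplus> i \<le> (d \<oplus> e) \<oplus> l\<close> for some \<open>l \<in> I\<close>; for \<open>e \<in> I\<close> this is (GCR), and (R2)
  reduces the general case to that one.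
\<close>

section \<open>Differences, (R2) and similarity expressed through summands\<close>

locale cancellative_conjugating =
  fixes S :: "'a partial_op"
  assumes conj: "S a b = Some s \<Longrightarrow> (\<exists>d e. S d a = Some s \<and> S b e = Some s)"
    and cancel_right: "S a c = Some s \<Longrightarrow> S b c = Some s \<Longrightarrow> a = b"
    and cancel_left: "S c a = Some s \<Longrightarrow> S c b = Some s \<Longrightarrow> a = b"
begin

lemma le_iff_right_summand: "le S a b \<longleftrightarrow> (\<exists>c. S c a = Some b)"
  unfolding le_def using conj by blast

lemma ldiff_eq: "S a c = Some b \<Longrightarrow> ldiff S a b = c"
  unfolding ldiff_def using cancel_left by blast

lemma rdiff_eq: "S d a = Some b \<Longrightarrow> rdiff S b a = d"
  unfolding rdiff_def using cancel_right by blast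

text \<open>Naming a difference by a summand \<open>d\<close> with \<open>S d i = Some a\<close>
  removes the definite descriptions. The statement lives in this locale because it serves both
  \<open>S\<close> and the unitization.\<close>

lemma riesz2_iff:
  "riesz2 S I \<longleftrightarrow>
     (\<forall>i\<in>I. \<forall>d a b. S d i = Some a \<and> S d b \<noteq> None \<longrightarrow>
        (\<exists>j\<in>I. \<exists>c. S j c = Some b \<and> S a c \<noteq> None)) \<and>
     (\<forall>i\<in>I. \<forall>c a b. S i c = Some a \<and> S b c \<noteq> None \<longrightarrow>
        (\<exists>k\<in>I. \<exists>d. S d k = Some b \<and> S d a \<noteq> None))"
  (is "_ \<longleftrightarrow> ?A \<and> ?B")
proof
  assume R: "riesz2 S I"
  have ?A
  proof (intro ballI allI impI)
    fix i d a b assume i: "i \<in> I" and h: "S d i = Some a \<and> S d b \<noteq> None"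
    then have "le S i a" "sum_defined S (rdiff S a i) b"
      by (auto simp: le_iff_right_summand rdiff_eq sum_defined_def)
    with R i obtain j where "j \<in> I" "le S j b" "sum_defined S a (ldiff S j b)"
      unfolding riesz2_def by blast
    then show "\<exists>j\<in>I. \<exists>c. S j c = Some b \<and> S a c \<noteq> None"
      by (fastforce simp: le_def sum_defined_def ldiff_eq)
  qed
  moreover have ?B
  proof (intro ballI allI impI)
    fix i c a b assume i: "i \<in> I" and h: "S i c = Some a \<and> S b c \<noteq> None"
    then have "le S i a" "sum_defined S b (ldiff S i a)"
      by (auto simp: le_def ldiff_eq sum_defined_def)
    with R i obtain k where "k \<in> I" "le S k b" "sum_defined S (rdiff S b k) a"
      unfolding riesz2_def by blast
    then show "\<exists>k\<in>I. \<exists>d. S d k = Some b \<and> S d a \<noteq> None"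
      by (fastforce simp: le_iff_right_summand sum_defined_def rdiff_eq)
  qed
  ultimately show "?A \<and> ?B" ..
next
  assume R: "?A \<and> ?B"
  show "riesz2 S I"
    unfolding riesz2_def
  proof (intro allI impI conjI)
    fix i a b assume i: "i \<in> I \<and> le S i a" and "sum_defined S (rdiff S a i) b"
    then obtain d where d: "S d i = Some a" "S d b \<noteq> None"
      by (auto simp: le_iff_right_summand sum_defined_def rdiff_eq)
    with R i obtain j c where "j \<in> I" "S j c = Some b" "S a c \<noteq> None"
      by blast
    then show "\<exists>j\<in>I. le S j b \<and> sum_defined S a (ldiff S j b)"
      by (auto simp: le_def sum_defined_def ldiff_eq intro!: bexI[of _ j])
  next
    fix i a b assume i: "i \<in> I \<and> le S i a" and "sum_defined S b (ldiff S i a)"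
    then obtain c where c: "S i c = Some a" "S b c \<noteq> None"
      by (auto simp: le_def sum_defined_def ldiff_eq)
    with R i obtain k d where "k \<in> I" "S d k = Some b" "S d a \<noteq> None"
      by blast
    then show "\<exists>k\<in>I. le S k b \<and> sum_defined S (rdiff S b k) a"
      by (auto simp: le_iff_right_summand sum_defined_def rdiff_eq intro!: bexI[of _ k])
  qed
qed

lemma ideal_sim_iff:
  "ideal_sim S I a b \<longleftrightarrow> (\<exists>i\<in>I. \<exists>j\<in>I. \<exists>d. S d i = Some a \<and> S d j = Some b)"
proof
  assume "ideal_sim S I a b"
  then obtain i j where ij: "i \<in> I" "j \<in> I" "le S i a" "le S j b" "rdiff S a i = rdiff S b j"
    unfolding ideal_sim_def by blast
  then obtain d e where "S d i = Some a" "S e j = Some b"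
    by (auto simp: le_iff_right_summand)
  with ij show "\<exists>i\<in>I. \<exists>j\<in>I. \<exists>d. S d i = Some a \<and> S d j = Some b"
    by (metis rdiff_eq)
next
  assume "\<exists>i\<in>I. \<exists>j\<in>I. \<exists>d. S d i = Some a \<and> S d j = Some b"
  then show "ideal_sim S I a b"
    unfolding ideal_sim_def by (metis rdiff_eq le_iff_right_summand)
qed

end

sublocale gpea \<subseteq> cancellative_conjugating S
  using conj cancel_right cancel_left by unfold_locales

section \<open>Rebracketing and monotonicity of sums\<close>

context gpea
begin

lemma assoc_right:
  assumes "S a b = Some s" "S s c = Some d"
  obtains t where "S b c = Some t" "S a t = Some d"
proof -
  have "Option.bind (S b c) (\<lambda>t. S a t) = Some d"
    using assoc[of a b c] assms by simp
  then show thesis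
    using that by (auto simp: bind_eq_Some_conv)
qed

lemma assoc_left:
  assumes "S b c = Some t" "S a t = Some d"
  obtains s where "S a b = Some s" "S s c = Some d"
proof -
  have "Option.bind (S a b) (\<lambda>s. S s c) = Some d"
    using assoc[of a b c] assms by simp
  then show thesis
    using that by (auto simp: bind_eq_Some_conv)
qed

lemma le_trans: "le S a b \<Longrightarrow> le S b c \<Longrightarrow> le S a c"
  unfolding le_def using assoc_right by metis

lemma sum_mono_right: "S b l = Some s \<Longrightarrow> le S k l \<Longrightarrow> \<exists>t. S b k = Some t"
  unfolding le_def using assoc_left by metis

lemma sum_mono_left: "S l a = Some s \<Longrightarrow> le S k l \<Longrightarrow> \<exists>t. S k a = Some t"
  unfolding le_iff_right_summand using assoc_right by metis

lemma sum_le_sum_right: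
  assumes "le S a b" "S d a = Some s" "S d b = Some t"
  shows "le S s t"
proof -
  obtain c where "S a c = Some b"
    using assms by (auto simp: le_def)
  then obtain s' where "S d a = Some s'" "S s' c = Some t"
    using assms assoc_left by metis
  with assms show ?thesis
    by (auto simp: le_def)
qed

lemma sum_le_sum_left:
  assumes "le S a b" "S a d = Some s" "S b d = Some t"
  shows "le S s t"
proof -
  obtain c where "S c a = Some b"
    using assms by (auto simp: le_iff_right_summand)
  then obtain s' where "S a d = Some s'" "S c s' = Some t"
    using assms assoc_right by metis
  with assms show ?thesis
    by (auto simp: le_iff_right_summand)
qed

end

section \<open>Normal Riesz ideals and (GCR) inside P\<close>

locale gpea_riesz_ideal = gpea S z for S :: "'a partial_op" and z +
  fixes I :: "'a set"
  assumes normal_riesz: "normal_riesz_ideal S I"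
begin

lemma ideal_downward: "b \<in> I \<Longrightarrow> le S a b \<Longrightarrow> a \<in> I"
  and ideal_sum: "a \<in> I \<Longrightarrow> b \<in> I \<Longrightarrow> S a b = Some s \<Longrightarrow> s \<in> I"
  and ideal_nonempty: "I \<noteq> {}"
  using normal_riesz unfolding normal_riesz_ideal_def is_ideal_def by blast+

lemma normalD: "S a c = Some s \<Longrightarrow> S c b = Some s \<Longrightarrow> a \<in> I \<longleftrightarrow> b \<in> I"
  using normal_riesz unfolding normal_riesz_ideal_def is_normal_def by blast

text \<open>Conjugation supplies the summand on the other side; normality, applied to i \<oplus> c =
  c \<oplus> j, keeps it in the ideal.\<close>

lemma move_right:
  assumes "S i c = Some s" "i \<in> I"
  obtains j where "j \<in> I" "S c j = Some s"
  using assms conj normalD by metis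

lemma move_left:
  assumes "S c i = Some s" "i \<in> I"
  obtains j where "j \<in> I" "S j c = Some s"
  using assms conj normalD by metis

lemma riesz1:
  assumes "i \<in> I" "S a b = Some s" "le S i s"
  obtains j k t where "j \<in> I" "k \<in> I" "S j k = Some t" "le S i t" "le S j a" "le S k b"
  using normal_riesz assms unfolding normal_riesz_ideal_def riesz1_def by blast

lemma riesz2:
  assumes "i \<in> I" "S d i = Some a" "S d b = Some s"
  obtains j c t where "j \<in> I" "S j c = Some b" "S a c = Some t"
proof -
  from normal_riesz have "riesz2 S I" unfolding normal_riesz_ideal_def by blast
  with assms show thesis using that unfolding riesz2_iff by blast
qed

lemma riesz2_left:
  assumes "i \<in> I" "S i c = Some a" "S b c = Some s"
  obtains k d t where "k \<in> I" "S d k = Some b" "S d a = Some t"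
proof -
  from normal_riesz have "riesz2 S I" unfolding normal_riesz_ideal_def by blast
  with assms show thesis using that unfolding riesz2_iff by blast
qed

lemma GCR_right_iff:
  "GCR S I \<longleftrightarrow>
     (\<forall>a b. ideal_sim S I a b \<longrightarrow> (\<exists>i\<in>I. \<exists>j\<in>I. \<exists>s. S a i = Some s \<and> S b j = Some s))"
  unfolding GCR_def by (meson move_left move_right)

text \<open>With s = b \<oplus> f, (R1) bounds i by some j \<oplus> k with j \<le> b and k \<le> f.
  Removing j from b and all of j \<oplus> k from s leaves comparable elements, and the latter is
  below a because i \<le> j \<oplus> k.\<close>

lemma subtract_ideal_element:
  assumes s: "S a i = Some s" and i: "i \<in> I" and b: "le S b s"
  obtains b' j where "j \<in> I" "S b' j = Some b" "le S b' a"
proof -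
  obtain f where f: "S b f = Some s"
    using b by (auto simp: le_def)
  have "le S i s"
    using s by (auto simp: le_iff_right_summand)
  then obtain j k t where jk: "j \<in> I" "k \<in> I" "S j k = Some t" "le S i t" "le S j b" "le S k f"
    using riesz1 i f by metis
  obtain b0 where b0: "S b0 j = Some b"
    using jk by (auto simp: le_iff_right_summand)
  obtain f' where f': "S k f' = Some f"
    using jk by (auto simp: le_def)
  obtain f0 where f0: "S f0 k = Some f"
    using jk by (auto simp: le_iff_right_summand)
  \<comment> \<open>Choosing the summands adjacent to each other in \<open>b \<oplus> f\<close> puts all of \<open>j \<oplus> k\<close> below \<open>s\<close>, so
     that \<open>a\<close> can be shrunk to \<open>a'\<close> with \<open>a' \<oplus> (j \<oplus> k) = s\<close>.\<close>
  have "le S t s"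
  proof -
    obtain u where u: "S b k = Some u" "S u f' = Some s"
      using assoc_left[OF f' f] .
    obtain v where v: "S j k = Some v" "S b0 v = Some u"
      using assoc_right[OF b0 u(1)] .
    with jk have "le S t u"
      by (auto simp: le_iff_right_summand)
    moreover have "le S u s"
      using u by (auto simp: le_def)
    ultimately show ?thesis
      by (rule le_trans)
  qed
  then obtain a' where a': "S a' t = Some s"
    by (auto simp: le_iff_right_summand)
  have "le S a' a"
  proof -
    obtain n where n: "S n i = Some t"
      using jk by (auto simp: le_iff_right_summand)
    obtain u where "S a' n = Some u" "S u i = Some s"
      using assoc_left[OF n a'] .
    with s show ?thesis
      by (auto simp: le_def dest: cancel_right)
  qed
  \<comment> \<open>Both a' \<oplus> j and b \<oplus> f0 arise from s by removing k on the right, so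
    they coincide. Conjugation puts b at the right end of this element; removing j there then
    compares b0 with a'.\<close>
  obtain p where p: "S a' j = Some p" "S p k = Some s"
    using assoc_left[OF jk(3) a'] .
  obtain q where q: "S b f0 = Some q" "S q k = Some s"
    using assoc_left[OF f0 f] .
  have "p = q"
    using cancel_right p q by blast
  with q obtain f1 where f1: "S f1 b = Some p"
    using conj by blast
  obtain u where u: "S f1 b0 = Some u" "S u j = Some p"
    using assoc_left[OF b0 f1] .
  have "u = a'"
    using cancel_right u p by blast
  then have "le S b0 a'"
    using u by (auto simp: le_iff_right_summand)
  with \<open>le S a' a\<close> show thesis
    using that jk(1) b0 le_trans by blast
qed

text \<open>(R2) writes e as j \<oplus> e' so that (d \<oplus> i) \<oplus> e' exists; this sum is
  similar to d \<oplus> e, and (GCR) bounds both. The bound is recorded as i \<le> e \<oplus> l,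
  without d, because (R1) is later applied to e \<oplus> l; adding d on the left recovers a \<le>
  w.\<close>

lemma common_upper_bound:
  assumes gcr: "GCR S I" and i: "i \<in> I" and di: "S d i = Some a" and de: "S d e = Some b"
  obtains l v w where "l \<in> I" "S e l = Some v" "S d v = Some w" "le S i v"
proof -
  obtain j e' t where j: "j \<in> I" "S j e' = Some e" "S a e' = Some t"
    using riesz2[OF i di de] .
  obtain j' where j': "j' \<in> I" "S e' j' = Some e"
    using move_right[OF j(2,1)] .
  \<comment> \<open>Moving i and j to the right of e' exhibits t and b as d \<oplus> e' followed by
    an element of I, which is similarity.\<close>
  obtain u where u: "S i e' = Some u" "S d u = Some t"
    using assoc_right[OF di j(3)] .
  obtain i' where i': "i' \<in> I" "S e' i' = Some u"
    using move_right[OF u(1) i] .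
  obtain f where f: "S d e' = Some f" "S f i' = Some t"
    using assoc_left[OF i'(2) u(2)] .
  obtain f2 where "S d e' = Some f2" "S f2 j' = Some b"
    using assoc_left[OF j'(2) de] .
  with f i' j' have "ideal_sim S I t b"
    unfolding ideal_sim_iff by auto
  then obtain k l w where kl: "l \<in> I" "S t k = Some w" "S b l = Some w"
    using gcr unfolding GCR_right_iff by blast
  \<comment> \<open>Cancelling d from the common bound w identifies e \<oplus> l with (i \<oplus>
    e') \<oplus> k, which is above i.\<close>
  obtain v where v: "S e l = Some v" "S d v = Some w"
    using assoc_right[OF de kl(3)] .
  obtain v' where v': "S u k = Some v'" "S d v' = Some w"
    using assoc_right[OF u(2) kl(2)] .
  have "v' = v"
    using cancel_left v v' by blast
  with u v' have "le S i u" "le S u v"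
    by (auto simp: le_def)
  then show thesis
    using that kl v le_trans by blast
qed

end

section \<open>Sums and order in the unitization\<close>

locale unitizable_gpea = gpea S z for S :: "'a partial_op" and z +
  fixes \<gamma> :: "'a \<Rightarrow> 'a"
  assumes unitizing: "unitizing S \<gamma>"
begin

abbreviation U :: "'a unitization partial_op" where
  "U \<equiv> unitization_sum S \<gamma>"

lemma bij_gamma: "bij \<gamma>"
  using unitizing unfolding unitizing_def gpea_automorphism_def by blast

lemma inv_gamma [simp]: "inv \<gamma> (\<gamma> a) = a" and gamma_inv [simp]: "\<gamma> (inv \<gamma> a) = a"
  using bij_gamma by (auto simp: bij_def surj_f_inv_f)

lemma gamma_eq_iff [simp]: "\<gamma> a = \<gamma> b \<longleftrightarrow> a = b"
  using bij_gamma by (auto simp: bij_def inj_eq)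

lemma gamma_sum_iff: "S (\<gamma> a) (\<gamma> b) = Some (\<gamma> s) \<longleftrightarrow> S a b = Some s"
  using unitizing unfolding unitizing_def gpea_automorphism_def gpea_morphism_def
  by (metis inv_gamma)

lemma gamma_sum_obtain:
  assumes "S (\<gamma> a) b = Some s"
  obtains b' s' where "b = \<gamma> b'" "s = \<gamma> s'" "S a b' = Some s'"
  using assms by (metis gamma_inv gamma_sum_iff)

lemma gamma_le_iff: "le S (\<gamma> a) (\<gamma> b) \<longleftrightarrow> le S a b"
  unfolding le_def by (metis gamma_sum_iff gamma_inv)

lemma gamma_swap: "(\<exists>s. S (\<gamma> a) b = Some s) \<longleftrightarrow> (\<exists>s. S b a = Some s)"
  using unitizing unfolding unitizing_def sum_defined_def by blast

lemma Emb_Emb_iff: "U (Emb a) (Emb b) = Some x \<longleftrightarrow> (\<exists>c. x = Emb c \<and> S a b = Some c)"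
  by auto

lemma Emb_Eta_iff: "U (Emb a) (Eta b) = Some x \<longleftrightarrow> (\<exists>c. x = Eta c \<and> S c a = Some b)"
  by (auto simp: le_iff_right_summand rdiff_eq dest: cancel_right)

lemma Eta_Emb_iff: "U (Eta a) (Emb b) = Some x \<longleftrightarrow> (\<exists>c. x = Eta c \<and> S (\<gamma> b) c = Some a)"
  by (auto simp: le_def ldiff_eq dest: cancel_left)

text \<open>These replace the defining equations, which are dropped as simp rules except the one for
  two \<open>Eta\<close> arguments; that one still closes its case by simplification.\<close>

lemmas U_iffs = Emb_Emb_iff Emb_Eta_iff Eta_Emb_iff

declare unitization_sum.simps(1-3) [simp del]

text \<open>Conjugation for the sum of \<open>Emb a\<close> and \<open>Eta b\<close>. The first
  witness is \<gamma> a \<oplus> c, which exists because c \<oplus> a does and \<gamma> is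
  unitizing; the second comes from conjugation in P and surjectivity of \<gamma>.\<close>

lemma Eta_summands:
  assumes "S c a = Some b"
  shows "\<exists>e g. U (Eta e) (Emb a) = Some (Eta c) \<and> U (Eta b) (Emb g) = Some (Eta c)"
proof -
  obtain e where "S (\<gamma> a) c = Some e"
    using gamma_swap assms by blast
  moreover obtain x where "S x c = Some b"
    using assms conj by blast
  ultimately show ?thesis
    unfolding Eta_Emb_iff by (metis gamma_inv)
qed

lemma Emb_summands:
  assumes "S (\<gamma> b) c = Some a"
  shows "\<exists>e g. U (Emb b) (Eta e) = Some (Eta c) \<and> U (Emb g) (Eta a) = Some (Eta c)"
proof -
  obtain e where "S c b = Some e"
    using gamma_swap assms by blast
  moreover obtain x where "S c x = Some a"
    using assms conj by blast
  ultimately show ?thesis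
    unfolding Emb_Eta_iff by blast
qed

text \<open>Makes \<open>U.riesz2_iff\<close> available, the form in which (R2) of the unitization
  is treated.\<close>

sublocale U: cancellative_conjugating U
proof
  fix x y w assume "U x y = Some w"
  then show "\<exists>d e. U d x = Some w \<and> U y e = Some w"
  proof (cases x; cases y)
    fix a b assume "x = Emb a" "y = Emb b"
    with \<open>U x y = Some w\<close> obtain c where c: "w = Emb c" "S a b = Some c"
      by (auto simp: U_iffs)
    from conj[OF c(2)] obtain d e where "S d a = Some c" "S b e = Some c" by blast
    then have "U (Emb d) x = Some w" "U y (Emb e) = Some w"
      using c \<open>x = Emb a\<close> \<open>y = Emb b\<close> by (auto simp: Emb_Emb_iff)
    then show ?thesis by blast
  next
    fix a b assume "x = Emb a" "y = Eta b"
    with \<open>U x y = Some w\<close> Eta_summands show ?thesis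
      by (fastforce simp: Emb_Eta_iff)
  next
    fix a b assume "x = Eta a" "y = Emb b"
    with \<open>U x y = Some w\<close> Emb_summands show ?thesis
      by (fastforce simp: Eta_Emb_iff)
  qed auto
next
  fix x y c w assume "U x c = Some w" "U y c = Some w"
  then show "x = y"
    using cancel_left cancel_right by (cases x; cases y; cases c) (auto simp: U_iffs)
next
  fix x y c w assume "U c x = Some w" "U c y = Some w"
  then show "x = y"
    using cancel_left cancel_right by (cases x; cases y; cases c) (auto simp: U_iffs dest: cancel_right)
qed

lemma le_Emb_Emb: "le U (Emb a) (Emb b) \<longleftrightarrow> le S a b"
proof
  assume "le U (Emb a) (Emb b)"
  then obtain x where "U (Emb a) x = Some (Emb b)"
    by (auto simp: le_def)
  then show "le S a b"
    by (cases x) (auto simp: U_iffs le_def)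
next
  assume "le S a b"
  then show "le U (Emb a) (Emb b)"
    unfolding le_def using Emb_Emb_iff by blast
qed

lemma le_Emb_Eta: "le U (Emb a) (Eta b) \<longleftrightarrow> (\<exists>s. S b a = Some s)"
proof
  assume "le U (Emb a) (Eta b)"
  then obtain x where "U (Emb a) x = Some (Eta b)"
    by (auto simp: le_def)
  then show "\<exists>s. S b a = Some s"
    by (cases x) (auto simp: U_iffs)
next
  assume "\<exists>s. S b a = Some s"
  then show "le U (Emb a) (Eta b)"
    unfolding le_def using Emb_Eta_iff by blast
qed

lemma not_le_Eta_Emb: "\<not> le U (Eta a) (Emb b)"
proof
  assume "le U (Eta a) (Emb b)"
  then obtain x where "U (Eta a) x = Some (Emb b)"
    by (auto simp: le_def)
  then show False
    by (cases x) (auto simp: U_iffs)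
qed

end

section \<open>The ideal inside the unitization, and its link to (GCR)\<close>

locale unitizable_gpea_riesz_ideal = unitizable_gpea S z \<gamma> + gpea_riesz_ideal S z I
  for S :: "'a partial_op" and z \<gamma> I +
  assumes gamma_closed: "gamma_closed \<gamma> I"
begin

lemma gamma_mem_iff: "\<gamma> a \<in> I \<longleftrightarrow> a \<in> I"
  using gamma_closed unfolding gamma_closed_def by blast

lemma inv_gamma_mem_iff: "inv \<gamma> a \<in> I \<longleftrightarrow> a \<in> I"
  by (metis gamma_inv gamma_mem_iff)

text \<open>
  The mirror image needs no repetition of the proof: \<open>d \<oplus> a\<close> exists iff \<open>\<gamma> a \<oplus> d\<close> does.
\<close>

lemma common_upper_bound_left:
  assumes gcr: "GCR S I" and i: "i \<in> I" and id: "S i d = Some a" and ed: "S e d = Some b"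
  obtains l v w where "l \<in> I" "S l e = Some v" "S v d = Some w" "le S i v"
proof -
  obtain a' b' where ab: "S d (inv \<gamma> i) = Some a'" "S d (inv \<gamma> e) = Some b'"
    using id ed by (metis gamma_inv gamma_swap)
  have "inv \<gamma> i \<in> I"
    using i inv_gamma_mem_iff by blast
  from common_upper_bound[OF gcr this ab] obtain l v w where
    l: "l \<in> I" "S (inv \<gamma> e) l = Some v" "S d v = Some w" "le S (inv \<gamma> i) v" .
  have "S e (\<gamma> l) = Some (\<gamma> v)"
    using l(2) by (metis gamma_inv gamma_sum_iff)
  then obtain l' where "l' \<in> I" "S l' e = Some (\<gamma> v)"
    using move_left l(1) gamma_mem_iff by metis
  moreover obtain w' where "S (\<gamma> v) d = Some w'"
    using gamma_swap l(3) by blast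
  moreover have "le S i (\<gamma> v)"
    using l(4) by (metis gamma_inv gamma_le_iff)
  ultimately show thesis
    using that by blast
qed

lemma ideal_unitization: "is_ideal U (Emb ` I)"
  unfolding is_ideal_def
proof (intro conjI allI impI)
  fix x y assume "y \<in> Emb ` I \<and> le U x y"
  then show "x \<in> Emb ` I"
    by (cases x) (auto simp: le_Emb_Emb not_le_Eta_Emb dest: ideal_downward)
next
  fix x y w assume "x \<in> Emb ` I \<and> y \<in> Emb ` I \<and> U x y = Some w"
  then obtain a b c where "a \<in> I" "b \<in> I" "S a b = Some c" "w = Emb c"
    by (auto simp: Emb_Emb_iff)
  then show "w \<in> Emb ` I"
    using ideal_sum by blast
qed (simp add: ideal_nonempty)

lemma normal_unitization: "is_normal U (Emb ` I)"
  unfolding is_normal_def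
proof (intro allI impI)
  fix x y c s assume h: "U x c = Some s \<and> U c y = Some s"
  show "x \<in> Emb ` I \<longleftrightarrow> y \<in> Emb ` I"
  proof (cases c)
    case (Emb c')
    with h show ?thesis
      by (cases x; cases y) (auto simp: U_iffs image_iff dest: normalD)
  next
    \<comment> \<open>For x = \<open>Emb a\<close>, y = \<open>Emb b\<close>, s =
      \<open>Eta t\<close> the two sums read t \<oplus> a = c' = \<gamma> b \<oplus> t, so normality
      in P relates a to \<gamma> b, and \<gamma>-closedness relates \<gamma> b to b.\<close>
    case (Eta c')
    with h show ?thesis
      by (cases x; cases y) (auto simp: U_iffs image_iff gamma_mem_iff dest: normalD)
  qed
qed

lemma riesz1_unitization:
  assumes gcr: "GCR S I"
  shows "riesz1 U (Emb ` I)"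
  unfolding riesz1_def
proof (intro allI impI)
  fix x y1 y2 s assume h: "x \<in> Emb ` I \<and> U y1 y2 = Some s \<and> le U x s"
  then obtain i where i: "x = Emb i" "i \<in> I" by blast
  have "\<exists>j\<in>I. \<exists>k\<in>I. \<exists>t. S j k = Some t \<and> le S i t \<and> le U (Emb j) y1 \<and> le U (Emb k) y2"
  proof (cases y1; cases y2)
    fix a b assume y: "y1 = Emb a" "y2 = Emb b"
    with h i obtain c where c: "S a b = Some c" "le S i c"
      by (auto simp: U_iffs le_Emb_Emb)
    show ?thesis
      using riesz1[OF i(2) c] unfolding y le_Emb_Emb by metis
  next
    fix a b assume y: "y1 = Emb a" "y2 = Eta b"
    with h i obtain d a0 where d: "S d a = Some b" "S d i = Some a0"
      by (auto simp: U_iffs le_Emb_Eta)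
    \<comment> \<open>In P, a alone need not bound i up to I, so a is enlarged by l and (R1) applied
      to a \<oplus> l. The part k \<le> l lies below \<open>Eta b\<close> since b \<oplus> l
      exists.\<close>
    obtain l v w where l: "l \<in> I" "S a l = Some v" "S d v = Some w" "le S i v"
      using common_upper_bound[OF gcr i(2) d(2,1)] .
    obtain j k t where
      jk: "j \<in> I" "k \<in> I" "S j k = Some t" "le S i t" "le S j a" "le S k l"
      using riesz1[OF i(2) l(2,4)] .
    obtain b' where "S d a = Some b'" "S b' l = Some w"
      using assoc_left[OF l(2,3)] .
    with d(1) have "S b l = Some w"
      by simp
    with jk(6) have "\<exists>s. S b k = Some s"
      using sum_mono_right by blast
    with jk show ?thesis
      unfolding y le_Emb_Emb le_Emb_Eta by blast
  next
    fix a b assume y: "y1 = Eta a" "y2 = Emb b"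
    with h i obtain c where c: "S (\<gamma> b) c = Some a" "\<exists>s. S c i = Some s"
      by (auto simp: U_iffs le_Emb_Eta)
    then obtain a0 where "S (\<gamma> i) c = Some a0"
      using gamma_swap by blast
    moreover have "\<gamma> i \<in> I"
      using i gamma_mem_iff by blast
    ultimately obtain l v w where
      l: "l \<in> I" "S l (\<gamma> b) = Some v" "S v c = Some w" "le S (\<gamma> i) v"
      using common_upper_bound_left[OF gcr _ _ c(1)] by blast
    \<comment> \<open>The bound was found for \<gamma> i; pulling it back along \<gamma> lets (R1)
      split i itself.\<close>
    have "S (inv \<gamma> l) b = Some (inv \<gamma> v)" "le S i (inv \<gamma> v)"
      using l by (metis gamma_inv gamma_sum_iff, metis gamma_inv gamma_le_iff)
    then obtain j k t where
      jk: "j \<in> I" "k \<in> I" "S j k = Some t" "le S i t" "le S j (inv \<gamma> l)" "le S k b"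
      using riesz1 i(2) by metis
    obtain a' where "S (\<gamma> b) c = Some a'" "S l a' = Some w"
      using assoc_right[OF l(2,3)] .
    with c(1) have "S l a = Some w"
      by simp
    moreover have "le S (\<gamma> j) l"
      using jk(5) by (metis gamma_inv gamma_le_iff)
    ultimately have "\<exists>s. S (\<gamma> j) a = Some s"
      using sum_mono_left by blast
    then have "\<exists>s. S a j = Some s"
      by (simp add: gamma_swap)
    with jk show ?thesis
      unfolding y le_Emb_Emb le_Emb_Eta by blast
  qed (use h in auto)
  then obtain j k t where jk: "j \<in> I" "k \<in> I" "S j k = Some t" "le S i t"
    "le U (Emb j) y1" "le U (Emb k) y2"
    by blast
  then have "U (Emb j) (Emb k) = Some (Emb t)" "le U x (Emb t)"
    by (simp_all add: i Emb_Emb_iff le_Emb_Emb)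
  with jk show "\<exists>j\<in>Emb ` I. \<exists>k\<in>Emb ` I. \<exists>t. U j k = Some t \<and> le U x t \<and> le U j y1 \<and> le U k y2"
    by blast
qed

text \<open>The kind of the mixed case is decided by the summand common to both given sums
  (\<open>d\<close>, then \<open>c\<close>): if it is an \<open>Eta\<close>,
  \<open>subtract_ideal_element\<close> applies; if it is an \<open>Emb\<close> and \<open>b\<close>
  is an \<open>Eta\<close>, a common upper bound, hence (GCR), is used.\<close>

lemma riesz2_unitization:
  assumes gcr: "GCR S I"
  shows "riesz2 U (Emb ` I)"
  unfolding U.riesz2_iff
proof (intro conjI ballI allI impI)
  fix x d a b assume "x \<in> Emb ` I" and h: "U d x = Some a \<and> U d b \<noteq> None"
  then obtain i where i: "x = Emb i" "i \<in> I" by blast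
  have "\<exists>j\<in>I. \<exists>c. U (Emb j) c = Some b \<and> U a c \<noteq> None"
  proof (cases d; cases b)
    fix d' b' assume db: "d = Emb d'" "b = Emb b'"
    with h i obtain a' s where a: "a = Emb a'" "S d' i = Some a'" "S d' b' = Some s"
      by (auto simp: U_iffs)
    obtain j c t where "j \<in> I" "S j c = Some b'" "S a' c = Some t"
      using riesz2[OF i(2) a(2,3)] .
    then have "U (Emb j) (Emb c) = Some b" "U a (Emb c) = Some (Emb t)"
      unfolding db a Emb_Emb_iff by auto
    with \<open>j \<in> I\<close> show ?thesis by blast
  next
    fix d' b' assume db: "d = Emb d'" "b = Eta b'"
    with h i obtain a' c where a: "a = Emb a'" "S d' i = Some a'" "S c d' = Some b'"
      by (auto simp: U_iffs)
    then obtain e where e: "S d' e = Some b'"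
      using conj by blast
    obtain l v w where l: "l \<in> I" "S e l = Some v" "S d' v = Some w" "le S i v"
      using common_upper_bound[OF gcr i(2) a(2) e] .
    obtain b'' where "S d' e = Some b''" "S b'' l = Some w"
      using assoc_left[OF l(2,3)] .
    \<comment> \<open>Removing l from \<open>Eta b'\<close> means adding l to b', so the remainder
      is \<open>Eta w\<close> with w = b' \<oplus> l.\<close>
    with e have "U (Emb l) (Eta w) = Some b"
      unfolding db Emb_Eta_iff by auto
    moreover have "le S a' w"
      using sum_le_sum_right[OF l(4) a(2) l(3)] .
    then have "U a (Eta w) \<noteq> None"
      using a(1) Emb_Eta_iff[of a' w] by (auto simp: le_iff_right_summand)
    ultimately show ?thesis using l(1) by blast
  next
    fix d' b' assume db: "d = Eta d'" "b = Emb b'"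
    with h i obtain a' c where a: "a = Eta a'" "S (\<gamma> i) a' = Some d'" "S (\<gamma> b') c = Some d'"
      by (auto simp: U_iffs)
    \<comment> \<open>Sums of \<open>Eta\<close> with \<open>Emb\<close> compare \<gamma>-images, so
      the subtraction is done on \<gamma> b' and the pieces are pulled back afterwards.\<close>
    obtain i1 where i1: "i1 \<in> I" "S a' i1 = Some d'"
      using move_right a(2) i(2) gamma_mem_iff by metis
    have "le S (\<gamma> b') d'"
      using a(3) by (auto simp: le_def)
    then obtain b0 j where "j \<in> I" "S b0 j = Some (\<gamma> b')" and le: "le S b0 a'"
      using subtract_ideal_element[OF i1(2,1)] by metis
    then obtain j' where j': "j' \<in> I" "S j' b0 = Some (\<gamma> b')"
      using move_left by metis
    then have "S (inv \<gamma> j') (inv \<gamma> b0) = Some b'"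
      by (metis gamma_inv gamma_sum_iff)
    then have "U (Emb (inv \<gamma> j')) (Emb (inv \<gamma> b0)) = Some b"
      unfolding db Emb_Emb_iff by blast
    moreover have "U a (Emb (inv \<gamma> b0)) \<noteq> None"
      using le a(1) Eta_Emb_iff[of a' "inv \<gamma> b0"] by (auto simp: le_def)
    ultimately show ?thesis
      using j'(1) inv_gamma_mem_iff by blast
  qed (use h i in auto)
  then show "\<exists>j\<in>Emb ` I. \<exists>c. U j c = Some b \<and> U a c \<noteq> None"
    by blast
next
  fix x c a b assume "x \<in> Emb ` I" and h: "U x c = Some a \<and> U b c \<noteq> None"
  then obtain i where i: "x = Emb i" "i \<in> I" by blast
  have "\<exists>k\<in>I. \<exists>d. U d (Emb k) = Some b \<and> U d a \<noteq> None"
  proof (cases c; cases b)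
    fix c' b' assume cb: "c = Emb c'" "b = Emb b'"
    with h i obtain a' s where a: "a = Emb a'" "S i c' = Some a'" "S b' c' = Some s"
      by (auto simp: U_iffs)
    obtain k d t where "k \<in> I" "S d k = Some b'" "S d a' = Some t"
      using riesz2_left[OF i(2) a(2,3)] .
    then have "U (Emb d) (Emb k) = Some b" "U (Emb d) a = Some (Emb t)"
      unfolding cb a Emb_Emb_iff by auto
    with \<open>k \<in> I\<close> show ?thesis by blast
  next
    fix c' b' assume cb: "c = Emb c'" "b = Eta b'"
    with h i obtain a' y where a: "a = Emb a'" "S i c' = Some a'" "S (\<gamma> c') y = Some b'"
      by (auto simp: U_iffs)
    then obtain e where e: "S e (\<gamma> c') = Some b'"
      using conj by blast
    have a2: "S (\<gamma> i) (\<gamma> c') = Some (\<gamma> a')"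
      using a(2) gamma_sum_iff by blast
    have "\<gamma> i \<in> I"
      using i gamma_mem_iff by blast
    from common_upper_bound_left[OF gcr this a2 e] obtain l v w where
      l: "l \<in> I" "S l e = Some v" "S v (\<gamma> c') = Some w" "le S (\<gamma> i) v" .
    obtain b'' where "S e (\<gamma> c') = Some b''" "S l b'' = Some w"
      using assoc_right[OF l(2,3)] .
    \<comment> \<open>Here w = l \<oplus> b', and the ideal element to remove is the
      \<gamma>-preimage of l, as a right summand \<open>Emb\<close> enters through \<gamma>.\<close>
    with e have "U (Eta w) (Emb (inv \<gamma> l)) = Some b"
      unfolding cb Eta_Emb_iff by auto
    moreover have "le S (\<gamma> a') w"
      using sum_le_sum_left[OF l(4) a2 l(3)] .
    then have "U (Eta w) a \<noteq> None"
      using a(1) Eta_Emb_iff[of w a'] by (auto simp: le_def)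
    ultimately show ?thesis
      using l(1) inv_gamma_mem_iff by blast
  next
    fix c' b' assume cb: "c = Eta c'" "b = Emb b'"
    with h i obtain a' y where a: "a = Eta a'" "S a' i = Some c'" "S y b' = Some c'"
      by (auto simp: U_iffs)
    then have "le S b' c'"
      by (auto simp: le_iff_right_summand)
    then obtain b0 j where j: "j \<in> I" "S b0 j = Some b'" and le: "le S b0 a'"
      using subtract_ideal_element[OF a(2) i(2)] by metis
    have "U (Emb b0) (Emb j) = Some b"
      unfolding cb Emb_Emb_iff using j by blast
    moreover have "U (Emb b0) a \<noteq> None"
      using le a(1) Emb_Eta_iff[of b0 a'] by (auto simp: le_iff_right_summand)
    ultimately show ?thesis
      using j by blast
  qed (use h i in auto)
  then show "\<exists>k\<in>Emb ` I. \<exists>d. U d k = Some b \<and> U d a \<noteq> None"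
    by blast
qed

text \<open>For a = d \<oplus> i and b = d \<oplus> j, the sum of \<open>Emb d\<close> and
  \<open>Eta b\<close> exists. (R2) shrinks \<open>Eta b\<close> to
  \<open>Eta (b \<oplus> l)\<close> with l in I so that \<open>Emb a\<close> can be added, which
  says a \<le> b \<oplus> l.\<close>

lemma GCR_if_riesz2_unitization:
  assumes R: "riesz2 U (Emb ` I)"
  shows "GCR S I"
  unfolding GCR_right_iff ideal_sim_iff
proof (intro allI impI)
  fix a b assume "\<exists>i\<in>I. \<exists>j\<in>I. \<exists>d. S d i = Some a \<and> S d j = Some b"
  then obtain i j d where ij: "i \<in> I" "j \<in> I" and a: "S d i = Some a" and b: "S d j = Some b"
    by blast
  have "U (Emb d) (Emb i) = Some (Emb a)"
    using a by (simp add: Emb_Emb_iff)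
  moreover have "U (Emb d) (Eta b) \<noteq> None"
    using conj[OF b] Emb_Eta_iff[of d b] by auto
  ultimately obtain l x where
    l: "l \<in> I" "U (Emb l) x = Some (Eta b)" and x: "U (Emb a) x \<noteq> None"
    using R ij(1) unfolding U.riesz2_iff by blast
  then obtain s where s: "x = Eta s" "S b l = Some s"
    by (cases x) (auto simp: U_iffs)
  with x obtain f where f: "S a f = Some s"
    using conj by (fastforce simp: Emb_Eta_iff)
  \<comment> \<open>Cancelling d gives i \<oplus> f = j \<oplus> l; the right side is in I, hence so
    is f.\<close>
  obtain p where p: "S i f = Some p" "S d p = Some s"
    using assoc_right[OF a f] .
  obtain q where q: "S j l = Some q" "S d q = Some s"
    using assoc_right[OF b s(2)] .
  have "p = q"
    using cancel_left p q by blast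
  then have "p \<in> I"
    using ideal_sum ij l q by blast
  then have "f \<in> I"
    using p le_iff_right_summand ideal_downward by blast
  with f s l show "\<exists>i\<in>I. \<exists>j\<in>I. \<exists>s. S a i = Some s \<and> S b j = Some s"
    by blast
qed

end

theorem theorem4p20:
  fixes S :: "'a partial_op" and z :: 'a and \<gamma> :: "'a \<Rightarrow> 'a" and I :: "'a set"
  assumes "gpea S z"
    and "unitizing S \<gamma>"
    and "normal_riesz_ideal S I"
    and "gamma_closed \<gamma> I"
  shows "normal_riesz_ideal (unitization_sum S \<gamma>) (Emb ` I) \<longleftrightarrow> GCR S I"
proof -
  interpret unitizable_gpea_riesz_ideal S z \<gamma> I
    using assms
    by (simp add: unitizable_gpea_riesz_ideal_def unitizable_gpea_riesz_ideal_axioms_def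
        unitizable_gpea_def unitizable_gpea_axioms_def
        gpea_riesz_ideal_def gpea_riesz_ideal_axioms_def)
  show ?thesis
    using ideal_unitization normal_unitization riesz1_unitization riesz2_unitization
      GCR_if_riesz2_unitization
    unfolding normal_riesz_ideal_def by blast
qed

end
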